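(* Let $n\ge3$ and $0<k\le\lfloor n/2\rfloor$. Then $\mathrm{Des}$ on $\mathrm{SYT}\big((n-k,n-k,n-2k)/(n-2k,n-2k)\big)$ has a cyclic extension $(\mathrm{cDes},\phi)$, where $\mathrm{cDes}$ is the map defined in the context and the bijection $\phi:\mathrm{SYT}\big((n-k,n-k,n-2k)/(n-2k,n-2k)\big)\to\mathrm{SYT}\big((n-k,n-k,n-2k)/(n-2k,n-2k)\big)$ is the promotion operator, $\phi:=\mathrm{pro}$.
   Context: Write $[n]=\{1,\dots,n\}$ and let $2^{X}$ denote the power set of $X$. Cyclic extension. Let $\mathcal F$ be a finite set with a map $\mathrm{Des}:\mathcal F\to 2^{[n-1]}$. A cyclic extension of $\mathrm{Des}$ is a pair $(\mathrm{cDes},p)$, where $\mathrm{cDes}:\mathcal F\to 2^{[n]}$ is a map and $p:\mathcal F\to\mathcal F$ is a bijection, such that for all $F\in\mathcal F$: (extension) $\mathrm{cDes}(F)\cap[n-1]=\mathrm{Des}(F)$; (equivariance) $\mathrm{cDes}(p(F))=\mathrm{cDes}(F)+1$, where $1$ is added to every element modulo $n$ (so $n$ becomes $1$); (non-Escher) $\varnothing\subsetneq \mathrm{cDes}(F)\subsetneq[n]$. Tableaux. Diagrams are drawn with rows numbered from top to bottom, left-justified. A standard Young tableau (SYT) of skew shape $\lambda/\mu$ with $n$ cells is a filling of the cells with $1,\dots,n$, each used once, increasing along rows from left to right and down columns from top to bottom. $\mathrm{SYT}(\lambda/\mu)$ is the set of these. The descent set is $\mathrm{Des}(T)=\{i\in[n-1]: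 i+1\text{ is in a lower row than } i\text{ in }T\}$. In the shape $(n-k,n-k,n-2k)/(n-2k,n-2k)$, the first and second rows occupy columns $n-2k+1,\dots,n-k$ ($k$ cells each), and the third row occupies columns $1,\dots,n-2k$. Cyclic descents. For $T\in\mathrm{SYT}((n-k,n-k,n-2k)/(n-2k,n-2k))$ let $T_{r,j}$ be the $j$th entry from the left in row $r$ of $T$. Set $\mathrm{cDes}(T)\cap[n-1]=\mathrm{Des}(T)$, and let $n\in\mathrm{cDes}(T)$ if and only if one of the following holds: (1) $1$ is in the third row and $n$ is in the second row of $T$; (2) $1$ is in the first row and $n$ is in the second row of $T$, and $T_{2,i-1}>T_{1,i}$ for every $1<i\le k$. Promotion. For $T\in\mathrm{SYT}(\lambda/\mu)$ of size $n$, $\mathrm{pro}(T)$ is obtained as follows: add $1$ modulo $n$ to each entry of $T$ (so $n$ becomes $1$ and every other entry is incremented); then repeatedly swap the entry $1$ with the larger of its northern neighbor (if it exists) and its western neighbor (if it exists), until the cell containing $1$ has neither a northern nor a western neighbor. *)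

theory Defs
  imports Complex_Main "HOL-Library.FuncSet" "HOL-Combinatorics.Transposition"
begin

text \<open>A cell is a pair (row, column), both counted from 1, rows from top to bottom. A partition is
  the list of its parts, extended by zeros.\<close>

type_synonym cell = "nat \<times> nat"

definition part :: "nat list \<Rightarrow> nat \<Rightarrow> nat" where
  "part xs i = (if i \<in> {1..length xs} then xs ! (i - 1) else 0)"

definition skew_diagram :: "nat list \<Rightarrow> nat list \<Rightarrow> cell set" where
  "skew_diagram lam mu = {(i, j). i \<in> {1..length lam} \<and> part mu i < j \<and> j \<le> part lam i}"

text \<open>Tableaux are \<^const>\<open>undefined\<close> outside the diagram, so that they are determined by their
  entries.\<close>

definition SYT :: "cell set \<Rightarrow> (cell \<Rightarrow> nat) set" where
  "SYT D = {T \<in> extensional D.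
     bij_betw T D {1..card D} \<and>
     (\<forall>i j j'. (i, j) \<in> D \<and> (i, j') \<in> D \<and> j < j' \<longrightarrow> T (i, j) < T (i, j')) \<and>
     (\<forall>i i' j. (i, j) \<in> D \<and> (i', j) \<in> D \<and> i < i' \<longrightarrow> T (i, j) < T (i', j))}"

definition row_of :: "cell set \<Rightarrow> (cell \<Rightarrow> nat) \<Rightarrow> nat \<Rightarrow> nat" where
  "row_of D T m = fst (inv_into D T m)"

definition Des :: "cell set \<Rightarrow> (cell \<Rightarrow> nat) \<Rightarrow> nat set" where
  "Des D T = {i \<in> {1..card D - 1}. row_of D T i < row_of D T (i + 1)}"

text \<open>On \<open>{1..n}\<close>, the map \<open>i \<mapsto> i mod n + 1\<close> adds 1 modulo n with representatives \<open>1, \<dots>, n\<close>.\<close>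

definition cyc_succ :: "nat \<Rightarrow> nat \<Rightarrow> nat" where
  "cyc_succ n i = i mod n + 1"

definition cyclic_extension ::
    "nat \<Rightarrow> 'a set \<Rightarrow> ('a \<Rightarrow> nat set) \<Rightarrow> ('a \<Rightarrow> nat set) \<Rightarrow> ('a \<Rightarrow> 'a) \<Rightarrow> bool" where
  "cyclic_extension n \<F> des cdes p \<longleftrightarrow>
     finite \<F> \<and> des \<in> \<F> \<rightarrow> Pow {1..n - 1} \<and>
     cdes \<in> \<F> \<rightarrow> Pow {1..n} \<and> bij_betw p \<F> \<F> \<and>
     (\<forall>F\<in>\<F>. cdes F \<inter> {1..n - 1} = des F \<and>
             cdes (p F) = cyc_succ n ` cdes F \<and>
             {} \<subset> cdes F \<and> cdes F \<subset> {1..n})"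

text \<open>\<open>slide D i j T\<close> repeatedly swaps the entry in cell \<open>(i, j)\<close> with the larger of the entries
  of its northern and western neighbours in \<open>D\<close>, following the moving entry.\<close>

function slide :: "cell set \<Rightarrow> nat \<Rightarrow> nat \<Rightarrow> (cell \<Rightarrow> nat) \<Rightarrow> cell \<Rightarrow> nat" where
  "slide D i j T =
    (if (1 < i \<and> (i - 1, j) \<in> D) \<and>
        ((1 < j \<and> (i, j - 1) \<in> D) \<longrightarrow> T (i, j - 1) < T (i - 1, j))
     then slide D (i - 1) j (T \<circ> transpose (i, j) (i - 1, j))
     else if 1 < j \<and> (i, j - 1) \<in> D
     then slide D i (j - 1) (T \<circ> transpose (i, j) (i, j - 1))
     else T)"
  by pat_completeness auto
termination by (relation "measure (\<lambda>(D, i, j, T). i + j)") auto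

declare slide.simps [simp del]

definition pro :: "cell set \<Rightarrow> (cell \<Rightarrow> nat) \<Rightarrow> cell \<Rightarrow> nat" where
  "pro D T =
    (let T' = restrict (\<lambda>c. cyc_succ (card D) (T c)) D;
         (i, j) = inv_into D T' 1
     in slide D i j T')"

definition strip_outer :: "nat \<Rightarrow> nat \<Rightarrow> nat list" where
  "strip_outer n k = [n - k, n - k, n - 2 * k]"

definition strip_inner :: "nat \<Rightarrow> nat \<Rightarrow> nat list" where
  "strip_inner n k = [n - 2 * k, n - 2 * k]"

definition strip_shape :: "nat \<Rightarrow> nat \<Rightarrow> cell set" where
  "strip_shape n k = skew_diagram (strip_outer n k) (strip_inner n k)"

lemma card_strip_shape:
  assumes "k \<le> n div 2"
  shows "card (strip_shape n k) = n"
proof -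
  have "part (strip_outer n k) 1 = n - k" "part (strip_outer n k) 2 = n - k"
      "part (strip_outer n k) 3 = n - 2 * k" "part (strip_inner n k) 1 = n - 2 * k"
      "part (strip_inner n k) 2 = n - 2 * k" "part (strip_inner n k) 3 = 0"
    by (simp_all add: part_def strip_outer_def strip_inner_def)
  moreover have "{1..length (strip_outer n k)} = {1, 2, 3}"
    by (auto simp: strip_outer_def)
  ultimately have eq: "strip_shape n k =
      {1, 2} \<times> {n - 2 * k <.. n - k} \<union> {3} \<times> {1..n - 2 * k}"
    unfolding strip_shape_def skew_diagram_def by fastforce
  show ?thesis unfolding eq
    using assms by (subst card_Un_disjoint) (auto simp: card_cartesian_product)
qed

text \<open>The \<open>j\<close>th entry from the left in row \<open>r\<close>; row \<open>r\<close> starts in column \<open>part (strip_inner n k) r + 1\<close>.\<close>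

definition strip_entry :: "nat \<Rightarrow> nat \<Rightarrow> (cell \<Rightarrow> nat) \<Rightarrow> nat \<Rightarrow> nat \<Rightarrow> nat" where
  "strip_entry n k T r j = T (r, part (strip_inner n k) r + j)"

definition strip_cDes :: "nat \<Rightarrow> nat \<Rightarrow> (cell \<Rightarrow> nat) \<Rightarrow> nat set" where
  "strip_cDes n k T =
    (let D = strip_shape n k in
     Des D T \<union>
     (if (row_of D T 1 = 3 \<and> row_of D T n = 2) \<or>
         (row_of D T 1 = 1 \<and> row_of D T n = 2 \<and>
          (\<forall>i. 1 < i \<and> i \<le> k \<longrightarrow> strip_entry n k T 2 (i - 1) > strip_entry n k T 1 i))
      then {n} else {}))"

end

(* Write w for the word of row numbers of the entries 1, ..., n. Its letters 1 and 2 form a ballot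
   word. If w = x 3, promotion gives 3 x; if w = u 1 v 2 with u and v balanced (ignoring the letter
   3), it gives 1 u 2 v. So promotion rotates w, except that the letter 1 between u and v, the
   "pivot" below, becomes 2; it sits in the column where the slide turns north. A balanced word
   neither begins with 2 nor ends with 1, and n is a cyclic descent iff w_n = 2 and either w_1 = 3
   or the pivot is the first letter; comparing adjacent letters gives equivariance. As 1 u 2 is the
   shortest nonempty balanced prefix of 1 u 2 v, the image determines the pivot, so promotion is
   injective. *)

theory Submission
  imports Defs
begin

section \<open>Slides\<close>

text \<open>The composite of the swaps made by an entry travelling west in row \<open>r\<close> from
  column \<open>l\<close> to column \<open>j\<close>: each entry it passes moves one column
  east.\<close>

definition row_shift :: "nat \<Rightarrow> nat \<Rightarrow> nat \<Rightarrow> (cell \<Rightarrow> 'a) \<Rightarrow> cell \<Rightarrow> 'a" where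
  "row_shift r j l T = (\<lambda>(x, y).
     if x = r \<and> y = j then T (r, l)
     else if x = r \<and> j < y \<and> y \<le> l then T (r, y - 1)
     else T (x, y))"

lemma row_shift_refl [simp]: "row_shift r l l T = T"
  by (auto simp: row_shift_def fun_eq_iff)

lemma row_shift_transpose:
  assumes "j < l"
  shows "row_shift r (Suc j) l T \<circ> transpose (r, Suc j) (r, j) = row_shift r j l T"
  using assms by (auto simp: row_shift_def fun_eq_iff transpose_def)

lemma slide_west:
  assumes "1 < j" "(i, j - 1) \<in> D"
    and "1 < i \<Longrightarrow> (i - 1, j) \<in> D \<Longrightarrow> T (i - 1, j) \<le> T (i, j - 1)"
  shows "slide D i j T = slide D i (j - 1) (T \<circ> transpose (i, j) (i, j - 1))"
  by (subst slide.simps) (use assms in auto)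

lemma slide_north:
  assumes "1 < i" "(i - 1, j) \<in> D"
    and "1 < j \<Longrightarrow> (i, j - 1) \<in> D \<Longrightarrow> T (i, j - 1) < T (i - 1, j)"
  shows "slide D i j T = slide D (i - 1) j (T \<circ> transpose (i, j) (i - 1, j))"
  by (subst slide.simps) (use assms in auto)

lemma slide_stop:
  assumes "\<not> (1 < i \<and> (i - 1, j) \<in> D)" "\<not> (1 < j \<and> (i, j - 1) \<in> D)"
  shows "slide D i j T = T"
  by (subst slide.simps) (use assms in auto)

text \<open>When the moving entry stands in column \<open>y\<close>, the two entries to compare lie
  outside the part already shifted. The conditions can therefore refer to the initial
  \<open>T\<close>, and the induction adds one swap at the western end.\<close>

lemma slide_west_run:
  assumes "1 \<le> j" "j \<le> l"
    and "\<And>y. j < y \<Longrightarrow> y \<le> l \<Longrightarrow> (r, y - 1) \<in> D"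
    and "\<And>y. j < y \<Longrightarrow> y \<le> l \<Longrightarrow> 1 < r \<Longrightarrow> (r - 1, y) \<in> D \<Longrightarrow> T (r - 1, y) \<le> T (r, y - 1)"
  shows "slide D r l T = slide D r j (row_shift r j l T)"
  using assms(2,1,3,4)
proof (induction j rule: inc_induct)
  case base
  then show ?case by simp
next
  case (step j)
  have "slide D r l T = slide D r (Suc j) (row_shift r (Suc j) l T)"
    using step by auto
  also have "\<dots> = slide D r j (row_shift r (Suc j) l T \<circ> transpose (r, Suc j) (r, j))"
    using step.hyps step.prems(1) step.prems(2)[of "Suc j"] step.prems(3)[of "Suc j"]
    by (subst slide_west) (auto simp: row_shift_def)
  finally show ?case
    using step.hyps by (simp add: row_shift_transpose)
qed

section \<open>Tableaux of strip shape\<close>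

lemma row_of_entry:
  assumes "T \<in> SYT D" "c \<in> D"
  shows "row_of D T (T c) = fst c"
  using assms by (simp add: row_of_def SYT_def bij_betw_def inv_into_f_f)

lemma finite_SYT:
  assumes "finite D"
  shows "finite (SYT D)"
proof (rule finite_subset)
  show "SYT D \<subseteq> D \<rightarrow>\<^sub>E {1..card D}"
    by (auto simp: SYT_def PiE_def bij_betw_def)
  show "finite (D \<rightarrow>\<^sub>E {1..card D})"
    using assms by (intro finite_PiE) auto
qed

locale strip =
  fixes n k :: nat
  assumes n3: "n \<ge> 3" and k0: "0 < k" and kn: "k \<le> n div 2"
begin

abbreviation D where "D \<equiv> strip_shape n k"
abbreviation L where "L \<equiv> n - 2 * k"
abbreviation R where "R \<equiv> n - k"

lemma L_less_R: "L < R"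
  using k0 kn by linarith

lemma part_inner: "part (strip_inner n k) 1 = L" "part (strip_inner n k) 2 = L"
  by (simp_all add: part_def strip_inner_def)

lemma cell_iff:
  "(x, y) \<in> D \<longleftrightarrow> (x = 1 \<or> x = 2) \<and> L < y \<and> y \<le> R \<or> x = 3 \<and> 1 \<le> y \<and> y \<le> L"
proof -
  have *: "part (strip_outer n k) 1 = R" "part (strip_outer n k) 2 = R"
      "part (strip_outer n k) 3 = L" "part (strip_inner n k) 3 = 0"
    by (simp_all add: part_def strip_outer_def strip_inner_def)
  have "x \<in> {1..length (strip_outer n k)} \<longleftrightarrow> x = 1 \<or> x = 2 \<or> x = 3"
    by (auto simp: strip_outer_def)
  then show ?thesis
    unfolding strip_shape_def skew_diagram_def using * part_inner by auto
qed

lemma card_D: "card D = n"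
  using card_strip_shape kn .

lemma finite_D: "finite D"
  using card_D n3 by (intro card_ge_0_finite) auto

text \<open>Injectivity follows from surjectivity by counting, and neighbours suffice along a row.
  Row 3 shares no column with the other rows, so all column conditions are between rows 1 and
  2.\<close>

lemma SYT_I:
  assumes "T \<in> extensional D" "T ` D = {1..n}"
    and "\<And>x y. (x, y) \<in> D \<Longrightarrow> (x, Suc y) \<in> D \<Longrightarrow> T (x, y) < T (x, Suc y)"
    and "\<And>y. L < y \<Longrightarrow> y \<le> R \<Longrightarrow> T (1, y) < T (2, y)"
  shows "T \<in> SYT D"
proof -
  have "inj_on T D"
    using assms(2) card_D finite_D by (intro eq_card_imp_inj_on) auto
  moreover have "T (x, y) < T (x, y')" if "(x, y) \<in> D" "(x, y') \<in> D" "y < y'" for x y y'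
    using that(3,1,2)
  proof (induction y')
    case (Suc y')
    then have "(x, y') \<in> D"
      by (auto simp: cell_iff)
    with Suc assms(3)[of x y'] show ?case
      by (cases "y = y'") auto
  qed simp
  ultimately show ?thesis
    using assms by (auto simp: SYT_def card_D bij_betw_def cell_iff)
qed

end


locale strip_tableau = strip +
  fixes T :: "cell \<Rightarrow> nat"
  assumes T_SYT: "T \<in> SYT D"
begin

lemma T_extensional: "T \<in> extensional D"
  using T_SYT by (simp add: SYT_def)

lemma T_bij: "bij_betw T D {1..n}"
  using T_SYT by (simp add: SYT_def card_D)

lemma entry_range:
  assumes "c \<in> D"
  shows "1 \<le> T c" "T c \<le> n"
  using bij_betwE[OF T_bij] assms by auto

lemma entry_eq_iff: "c \<in> D \<Longrightarrow> c' \<in> D \<Longrightarrow> T c = T c' \<longleftrightarrow> c = c'"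
  using T_bij by (auto simp: bij_betw_def inj_on_eq_iff)

lemma entry_less_n: "c \<in> D \<Longrightarrow> c' \<in> D \<Longrightarrow> T c' = n \<Longrightarrow> c \<noteq> c' \<Longrightarrow> T c < n"
  using entry_range(2)[of c] entry_eq_iff[of c c'] by linarith

lemma entry_obtain:
  assumes "1 \<le> m" "m \<le> n"
  obtains x y where "(x, y) \<in> D" "T (x, y) = m"
  using T_bij assms by (metis atLeastAtMost_iff bij_betw_iff_bijections surj_pair)

lemma row_less: "(x, y) \<in> D \<Longrightarrow> (x, y') \<in> D \<Longrightarrow> y < y' \<Longrightarrow> T (x, y) < T (x, y')"
  using T_SYT by (auto simp: SYT_def)

lemma row_le: "(x, y) \<in> D \<Longrightarrow> (x, y') \<in> D \<Longrightarrow> y \<le> y' \<Longrightarrow> T (x, y) \<le> T (x, y')"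
  using row_less by (metis le_neq_implies_less less_imp_le_nat order_refl)

lemma column_less: "L < y \<Longrightarrow> y \<le> R \<Longrightarrow> T (1, y) < T (2, y)"
  using T_SYT by (auto simp: SYT_def cell_iff)

text \<open>The maximum has no eastern or southern neighbour, and every cell of row 1 has a cell of
  row 2 below it.\<close>

lemma max_entry_cases:
  obtains (row2) "T (2, R) = n" | (row3) "L \<ge> 1" "T (3, L) = n"
proof -
  obtain x y where xy: "(x, y) \<in> D" "T (x, y) = n"
    using n3 by (auto intro: entry_obtain[of n])
  consider "x = 1" | "x = 2" | "x = 3" using xy(1) by (auto simp: cell_iff)
  then show ?thesis
  proof cases
    case 1
    then show ?thesis
      using xy column_less[of y] entry_range(2)[of "(2, y)"] by (auto simp: cell_iff)
  next
    case 2
    then show ?thesis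
      using xy row_le[of 2 y R] entry_range(2)[of "(2, R)"] row2 by (auto simp: cell_iff)
  next
    case 3
    then show ?thesis
      using xy row_le[of 3 y L] entry_range(2)[of "(3, L)"] row3 by (auto simp: cell_iff)
  qed
qed

lemma row2_not_1: "(2, y) \<in> D \<Longrightarrow> T (2, y) \<noteq> 1"
  using column_less[of y] entry_range(1)[of "(1, y)"] by (auto simp: cell_iff)

section \<open>Promotion as an explicit slide\<close>

definition rot :: "cell \<Rightarrow> nat" where
  "rot = restrict (\<lambda>c. cyc_succ n (T c)) D"

lemma rot_less: "c \<in> D \<Longrightarrow> T c < n \<Longrightarrow> rot c = T c + 1"
  by (simp add: rot_def cyc_succ_def)

lemma rot_n: "c \<in> D \<Longrightarrow> T c = n \<Longrightarrow> rot c = 1"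
  by (simp add: rot_def cyc_succ_def)

lemma rot_outside: "c \<notin> D \<Longrightarrow> rot c = undefined"
  by (simp add: rot_def)

lemma pro_slide:
  assumes "(x, y) \<in> D" "T (x, y) = n"
  shows "pro D T = slide D x y rot"
proof -
  have "inj_on rot D"
  proof (rule inj_onI)
    fix c c' assume "c \<in> D" "c' \<in> D" "rot c = rot c'"
    then show "c = c'"
      using entry_range[of c] entry_range[of c'] entry_eq_iff[of c c']
        rot_less[of c] rot_less[of c'] rot_n[of c] rot_n[of c']
      by (cases "T c = n"; cases "T c' = n") auto
  qed
  then have "inv_into D rot 1 = (x, y)"
    using assms rot_n by (intro inv_into_f_eq) auto
  then show ?thesis
    by (simp add: pro_def rot_def card_D)
qed

text \<open>No cell of row 3 has a northern neighbour, so the 1 only runs west.\<close>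

lemma pro_row3:
  assumes "L \<ge> 1" "T (3, L) = n"
  shows "pro D T = row_shift 3 1 L rot"
proof -
  have "pro D T = slide D 3 L rot"
    using assms by (intro pro_slide) (auto simp: cell_iff)
  also have "\<dots> = slide D 3 1 (row_shift 3 1 L rot)"
    using assms by (intro slide_west_run) (auto simp: cell_iff)
  also have "\<dots> = row_shift 3 1 L rot"
    using assms by (intro slide_stop) (auto simp: cell_iff)
  finally show ?thesis .
qed

text \<open>The rightmost column of the first two rows at which the slide can turn north. Reading a
  tableau as a word in its row numbers, it is the column of the step leaving height 0 for the last
  time before the end.\<close>

definition crit :: nat where
  "crit = Max {y \<in> {L<..R}. y = L + 1 \<or> T (2, y - 1) < T (1, y)}"

lemma crit_bounds: "L < crit" "crit \<le> R"
  and crit_cases: "crit = L + 1 \<or> T (2, crit - 1) < T (1, crit)"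
proof -
  have "crit \<in> {y \<in> {L<..R}. y = L + 1 \<or> T (2, y - 1) < T (1, y)}"
    unfolding crit_def using L_less_R by (intro Max_in) (auto intro!: exI[of _ "L + 1"])
  then show "L < crit" "crit \<le> R" "crit = L + 1 \<or> T (2, crit - 1) < T (1, crit)"
    by auto
qed

text \<open>By maximality of \<open>crit\<close>; a tie is excluded because distinct cells carry
  distinct entries.\<close>

lemma crit_less:
  assumes "crit < y" "y \<le> R"
  shows "T (1, y) < T (2, y - 1)"
proof (rule ccontr)
  assume "\<not> T (1, y) < T (2, y - 1)"
  moreover have "T (1, y) \<noteq> T (2, y - 1)"
    using assms crit_bounds by (subst entry_eq_iff) (auto simp: cell_iff)
  ultimately have "y \<in> {y \<in> {L<..R}. y = L + 1 \<or> T (2, y - 1) < T (1, y)}"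
    using assms crit_bounds by auto
  then have "y \<le> crit"
    unfolding crit_def by (intro Max_ge) auto
  with assms show False by simp
qed

lemma crit_eq_iff: "crit = L + 1 \<longleftrightarrow> (\<forall>y. L + 1 < y \<and> y \<le> R \<longrightarrow> T (1, y) < T (2, y - 1))"
  using crit_less crit_cases crit_bounds
  by (metis Suc_eq_plus1 Suc_lessI less_asym)

text \<open>In row 2 the 1 runs west while its western neighbour exceeds its northern one, hence
  exactly to column \<open>crit\<close>. There it turns north, and in row 1 only western moves
  remain.\<close>

lemma pro_row2:
  assumes "T (2, R) = n"
  shows "pro D T =
    row_shift 1 (L + 1) crit (row_shift 2 crit R rot \<circ> transpose (2, crit) (1, crit))"
proof -
  let ?q = crit
  let ?U = "row_shift 2 ?q R rot"
  \<comment> \<open>Only the cell holding \<open>n\<close> wraps around; all other entries rise by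
    one, so comparisons among them are those of \<open>T\<close>.\<close>
  have small: "rot (x, y) = T (x, y) + 1" if "(x, y) \<in> D" "(x, y) \<noteq> (2, R)" for x y
    using that assms L_less_R entry_less_n[of "(x, y)" "(2, R)"] rot_less
    by (auto simp: cell_iff)
  have "pro D T = slide D 2 R rot"
    using assms L_less_R by (intro pro_slide) (auto simp: cell_iff)
  also have "\<dots> = slide D 2 ?q ?U"
  proof (rule slide_west_run)
    fix y assume y: "?q < y" "y \<le> R"
    show "(2, y - 1) \<in> D"
      using y crit_bounds by (auto simp: cell_iff)
    show "rot (2 - 1, y) \<le> rot (2, y - 1)"
    proof -
      have "L < y - 1" "y - 1 < R"
        using y crit_bounds by linarith+
      then show ?thesis
        using y crit_less[of y] small[of 1 y] small[of 2 "y - 1"] by (auto simp: cell_iff)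
    qed
  qed (use crit_bounds in auto)
  also have "\<dots> = slide D (2 - 1) ?q (?U \<circ> transpose (2, ?q) (2 - 1, ?q))"
  proof (rule slide_north)
    \<comment> \<open>A western neighbour exists only if \<open>crit\<close> is not the first
      column, and then \<open>crit_cases\<close> makes the northern one larger.\<close>
    assume "(2, ?q - 1) \<in> D"
    then show "?U (2, ?q - 1) < ?U (2 - 1, ?q)"
      using crit_bounds crit_cases by (auto simp: cell_iff row_shift_def small)
  qed (use crit_bounds in \<open>auto simp: cell_iff\<close>)
  also have "\<dots> = slide D 1 ?q (?U \<circ> transpose (2, ?q) (1, ?q))"
    by simp
  also have "\<dots> = slide D 1 (L + 1) (row_shift 1 (L + 1) ?q (?U \<circ> transpose (2, ?q) (1, ?q)))"
    using crit_bounds by (intro slide_west_run) (auto simp: cell_iff)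
  also have "\<dots> = row_shift 1 (L + 1) ?q (?U \<circ> transpose (2, ?q) (1, ?q))"
    by (intro slide_stop) (auto simp: cell_iff)
  finally show ?thesis .
qed

lemma pro_row3_entries:
  assumes "L \<ge> 1" "T (3, L) = n"
  shows "pro D T (3, 1) = 1"
    and "\<And>y. 1 \<le> y \<Longrightarrow> y < L \<Longrightarrow> pro D T (3, Suc y) = Suc (T (3, y))"
    and "\<And>x y. (x, y) \<in> D \<Longrightarrow> x \<noteq> 3 \<Longrightarrow> pro D T (x, y) = Suc (T (x, y))"
proof -
  have small: "rot (x, y) = T (x, y) + 1" if "(x, y) \<in> D" "(x, y) \<noteq> (3, L)" for x y
    using that assms entry_less_n[of "(x, y)" "(3, L)"] rot_less by (auto simp: cell_iff)
  show "pro D T (3, 1) = 1"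
    using assms by (simp add: pro_row3 row_shift_def rot_n cell_iff)
  show "pro D T (3, Suc y) = Suc (T (3, y))" if "1 \<le> y" "y < L" for y
    using assms that by (simp add: pro_row3 row_shift_def small cell_iff)
  show "pro D T (x, y) = Suc (T (x, y))" if "(x, y) \<in> D" "x \<noteq> 3" for x y
    using assms that by (simp add: pro_row3 row_shift_def small)
qed

text \<open>Read off from the two row shifts and the swap between them. Apart from the wrapped
  \<open>n\<close>, only the entry of \<open>(1, crit)\<close> changes its row.\<close>

lemma pro_row2_entries:
  assumes "T (2, R) = n"
  shows "pro D T (1, L + 1) = 1"
    and "\<And>y. L < y \<Longrightarrow> y < crit \<Longrightarrow> pro D T (1, Suc y) = Suc (T (1, y))"
    and "\<And>y. crit < y \<Longrightarrow> y \<le> R \<Longrightarrow> pro D T (1, y) = Suc (T (1, y))"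
    and "\<And>y. L < y \<Longrightarrow> y < crit \<Longrightarrow> pro D T (2, y) = Suc (T (2, y))"
    and "pro D T (2, crit) = Suc (T (1, crit))"
    and "\<And>y. crit \<le> y \<Longrightarrow> y < R \<Longrightarrow> pro D T (2, Suc y) = Suc (T (2, y))"
    and "\<And>y. 1 \<le> y \<Longrightarrow> y \<le> L \<Longrightarrow> pro D T (3, y) = Suc (T (3, y))"
proof -
  have small: "rot (x, y) = T (x, y) + 1" if "(x, y) \<in> D" "(x, y) \<noteq> (2, R)" for x y
    using that assms L_less_R entry_less_n[of "(x, y)" "(2, R)"] rot_less
    by (auto simp: cell_iff)
  have rotR: "rot (2, R) = 1"
    using assms L_less_R by (intro rot_n) (auto simp: cell_iff)
  note * = pro_row2[OF assms] row_shift_def transpose_def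
  show "pro D T (1, L + 1) = 1"
    using crit_bounds rotR by (auto simp: *)
  show "pro D T (1, Suc y) = Suc (T (1, y))" if "L < y" "y < crit" for y
    using crit_bounds that by (auto simp: * small cell_iff)
  show "pro D T (1, y) = Suc (T (1, y))" if "crit < y" "y \<le> R" for y
    using crit_bounds that by (auto simp: * small cell_iff)
  show "pro D T (2, y) = Suc (T (2, y))" if "L < y" "y < crit" for y
    using crit_bounds that by (auto simp: * small cell_iff)
  show "pro D T (2, crit) = Suc (T (1, crit))"
    using crit_bounds by (auto simp: * small cell_iff)
  show "pro D T (2, Suc y) = Suc (T (2, y))" if "crit \<le> y" "y < R" for y
    using crit_bounds that by (auto simp: * small cell_iff)
  show "pro D T (3, y) = Suc (T (3, y))" if "1 \<le> y" "y \<le> L" for y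
    using crit_bounds that by (auto simp: * small cell_iff)
qed

section \<open>The promoted filling is a standard tableau\<close>

lemma pro_extensional: "pro D T \<in> extensional D"
proof (cases rule: max_entry_cases)
  case row2
  then show ?thesis
    using crit_bounds
    by (auto simp: extensional_def pro_row2 row_shift_def transpose_def cell_iff rot_outside)
next
  case row3
  then show ?thesis
    by (auto simp: extensional_def pro_row3 row_shift_def cell_iff rot_outside)
qed

text \<open>\<open>pro_cell c\<close> is the cell of \<open>pro D T\<close> that receives the incremented entry of \<open>c\<close>.\<close>

definition pro_cell :: "cell \<Rightarrow> cell" where
  "pro_cell = (\<lambda>(x, y).
     if T (2, R) = n then
       if x = 1 \<and> y < crit then (1, Suc y)
       else if x = 1 \<and> y = crit then (2, y)
       else if x = 2 \<and> crit \<le> y then (2, Suc y)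
       else (x, y)
     else if x = 3 then (3, Suc y) else (x, y))"

lemma pro_cell:
  assumes "c \<in> D" "T c < n"
  shows "pro_cell c \<in> D" "pro D T (pro_cell c) = Suc (T c)"
proof -
  obtain x y where c: "c = (x, y)" by fastforce
  have "pro_cell c \<in> D \<and> pro D T (pro_cell c) = Suc (T c)"
  proof (cases rule: max_entry_cases)
    case row2
    consider "x = 1" | "x = 2" "y < R" | "x = 3"
      using assms row2 by (auto simp: c cell_iff le_less)
    then show ?thesis
      using assms row2 crit_bounds
      by cases (auto simp: c pro_cell_def cell_iff pro_row2_entries[OF row2, simplified] not_less
          intro: le_neq_implies_less)
  next
    case row3
    have "T (2, R) \<noteq> n"
      using L_less_R row3 entry_eq_iff[of "(2, R)" "(3, L)"] by (auto simp: cell_iff)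
    moreover have "x = 3 \<longrightarrow> y < L"
      using assms row3 by (auto simp: c cell_iff le_less)
    ultimately show ?thesis
      using assms pro_row3_entries[OF row3] by (auto simp: c pro_cell_def cell_iff)
  qed
  then show "pro_cell c \<in> D" "pro D T (pro_cell c) = Suc (T c)"
    by auto
qed

text \<open>The value 1 ends up at the start of row 1 or of row 3, and \<open>pro_cell\<close>
  supplies the successors of all entries below \<open>n\<close>. Counting cells excludes further
  values.\<close>

lemma pro_image: "pro D T ` D = {1..n}"
proof -
  have "1 \<in> pro D T ` D"
  proof (cases rule: max_entry_cases)
    case row2
    then show ?thesis
      using L_less_R pro_row2_entries(1)
      by (intro image_eqI[of _ _ "(1, L + 1)"]) (auto simp: cell_iff)
  next
    case row3
    then show ?thesis
      using pro_row3_entries(1) by (intro image_eqI[of _ _ "(3, 1)"]) (auto simp: cell_iff)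
  qed
  moreover have "Suc m \<in> pro D T ` D" if m: "1 \<le> m" "m < n" for m
  proof -
    obtain x y where "(x, y) \<in> D" "T (x, y) = m"
      using m by (rule entry_obtain[OF _ less_imp_le])
    with pro_cell[of "(x, y)"] m show ?thesis
      by (metis imageI)
  qed
  ultimately have "m \<in> pro D T ` D" if "m \<in> {1..n}" for m
    using that by (cases m; cases "m = 1") (auto simp: Suc_le_eq)
  then have "{1..n} \<subseteq> pro D T ` D" by blast
  moreover have "card (pro D T ` D) \<le> card {1..n}"
    using card_image_le[OF finite_D] by (simp add: card_D)
  ultimately show ?thesis
    using finite_D by (metis card_seteq finite_imageI)
qed

text \<open>The new entry is 1 or the successor of the old western neighbour, so the shift east
  absorbs the increment.\<close>

lemma pro_row2_le:
  assumes "T (2, R) = n" "L < y" "y \<le> crit"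
  shows "pro D T (1, y) \<le> T (1, y)"
proof (cases "y = L + 1")
  case True
  then show ?thesis
    using assms crit_bounds entry_range(1)[of "(1, y)"] pro_row2_entries(1)
    by (auto simp: cell_iff)
next
  case False
  then obtain z where "y = Suc z" "L < z"
    using assms by (cases y) auto
  then show ?thesis
    using assms crit_bounds row_less[of 1 z y] pro_row2_entries(2)[of z] by (auto simp: cell_iff)
qed

lemma pro_row_less:
  assumes "(x, y) \<in> D" "(x, Suc y) \<in> D"
  shows "pro D T (x, y) < pro D T (x, Suc y)"
proof (cases rule: max_entry_cases)
  case row2
  note entries = pro_row2_entries[OF row2]
  have T_less: "T (x, y) < T (x, Suc y)"
    using assms by (intro row_less) auto
  consider "x = 1" "y < crit" | "x = 1" "y = crit" | "x = 1" "crit < y"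
    | "x = 2" "Suc y < crit" | "x = 2" "Suc y = crit" | "x = 2" "y = crit" | "x = 2" "crit < y"
    | "x = 3"
  proof -
    have "x = 1 \<or> x = 2 \<or> x = 3"
      using assms(1) by (auto simp: cell_iff)
    moreover have "Suc y < crit \<or> Suc y = crit \<or> y = crit \<or> crit < y"
      by linarith
    ultimately show ?thesis
      using that by (metis Suc_lessD lessI)
  qed
  then show ?thesis
  proof cases
    case 1
    then show ?thesis
      using assms pro_row2_le[OF row2, of y] entries(2)[of y] by (auto simp: cell_iff)
  next
    case 2
    then show ?thesis
      using assms pro_row2_le[OF row2, of y] entries(3)[of "Suc y"] T_less by (auto simp: cell_iff)
  next
    case 3
    then show ?thesis
      using assms entries(3)[of y] entries(3)[of "Suc y"] T_less by (auto simp: cell_iff)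
  next
    case 4
    then show ?thesis
      using assms entries(4)[of y] entries(4)[of "Suc y"] T_less by (auto simp: cell_iff)
  next
    case 5
    then show ?thesis
      \<comment> \<open>The new eastern entry comes from \<open>(1, crit)\<close>, so the inequality
        needed is the one that lets the slide turn north at \<open>crit\<close>.\<close>
      using assms crit_cases entries(4)[of y] entries(5) by (auto simp: cell_iff simp flip: 5(2))
  next
    case 6
    then show ?thesis
      \<comment> \<open>The two new entries come from \<open>(1, crit)\<close> and
        \<open>(2, crit)\<close>: the old column inequality becomes the row inequality.\<close>
      using assms crit_bounds column_less[of crit] entries(5) entries(6)[of y]
      by (auto simp: cell_iff)
  next
    case 7
    then obtain z where "y = Suc z" "crit \<le> z"
      by (cases y) auto
    with 7 show ?thesis
      using assms crit_bounds row_less[of 2 z y] entries(6)[of z] entries(6)[of y]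
      by (auto simp: cell_iff)
  next
    case 8
    then show ?thesis
      using assms entries(7)[of y] entries(7)[of "Suc y"] T_less by (auto simp: cell_iff)
  qed
next
  case row3
  note entries = pro_row3_entries[OF row3]
  consider "x \<noteq> 3" | "x = 3" "y = 1" | z where "x = 3" "y = Suc z" "1 \<le> z"
    using assms by (cases "y = 1"; cases y) (auto simp: cell_iff Suc_le_eq)
  then show ?thesis
  proof cases
    case 1
    then show ?thesis
      using assms row_less[of x y "Suc y"] entries(3) by auto
  next
    case 2
    then show ?thesis
      using assms entry_range(1)[of "(3, 1)"] entries(1) entries(2)[of 1] by (auto simp: cell_iff)
  next
    case 3
    then show ?thesis
      using assms row_less[of 3 z y] entries(2)[of z] entries(2)[of y] by (auto simp: cell_iff)
  qed
qed

text \<open>West of \<open>crit\<close> the lower entry grows and the upper one does not. At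
  \<open>crit\<close> the lower entry is the successor of the old upper one. East of
  \<open>crit\<close> the shift of row 2 pairs \<open>(1, y)\<close> with the old
  \<open>(2, y - 1)\<close>, which is \<open>crit_less\<close>.\<close>

lemma pro_column_less:
  assumes "L < y" "y \<le> R"
  shows "pro D T (1, y) < pro D T (2, y)"
proof (cases rule: max_entry_cases)
  case row2
  consider "y < crit" | "y = crit" | z where "y = Suc z" "crit \<le> z"
    by (metis less_Suc_eq_le less_imp_Suc_add linorder_cases le_add1)
  then show ?thesis
  proof cases
    case 1
    then show ?thesis
      using assms pro_row2_le[OF row2, of y] column_less[of y] pro_row2_entries(4)[OF row2, of y]
      by auto
  next
    case 2
    then show ?thesis
      using assms pro_row2_le[OF row2, of y] pro_row2_entries(5)[OF row2] by auto
  next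
    case 3
    then show ?thesis
      using assms crit_less[of y] pro_row2_entries(3)[OF row2, of y]
        pro_row2_entries(6)[OF row2, of z] by auto
  qed
next
  case row3
  then show ?thesis
    using assms column_less pro_row3_entries(3)[OF row3] by (auto simp: cell_iff)
qed

lemma pro_SYT: "pro D T \<in> SYT D"
  using pro_extensional pro_image pro_row_less pro_column_less by (rule SYT_I)

section \<open>Rows of consecutive entries\<close>

text \<open>\<open>row m\<close> is the letter in position \<open>m\<close> of the word w.\<close>

abbreviation row where "row \<equiv> row_of D T"

text \<open>The position in w of the letter that promotion changes when w ends in 2.\<close>

abbreviation pivot where "pivot \<equiv> T (1, crit)"

lemma row_entry: "(x, y) \<in> D \<Longrightarrow> row (T (x, y)) = x"
  using row_of_entry[OF T_SYT] by auto

lemma row_range: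
  assumes "1 \<le> m" "m \<le> n"
  shows "row m \<in> {1, 2, 3}"
proof -
  obtain x y where "(x, y) \<in> D" "T (x, y) = m"
    using assms by (rule entry_obtain)
  with row_entry show ?thesis
    by (auto simp: cell_iff)
qed

lemma obtain_column:
  assumes "1 \<le> m" "m \<le> n"
  obtains y where "(row m, y) \<in> D" "T (row m, y) = m"
  using assms row_entry by (metis entry_obtain)

lemma row_n: "row n = 2 \<longleftrightarrow> T (2, R) = n" "row n \<noteq> 2 \<longleftrightarrow> row n = 3"
proof -
  have "T (2, R) = n \<and> row n = 2 \<or> T (2, R) \<noteq> n \<and> row n = 3"
  proof (cases rule: max_entry_cases)
    case row2
    then show ?thesis
      using row_entry[of 2 R] L_less_R by (auto simp: cell_iff)
  next
    case row3
    then show ?thesis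
      using row_entry[of 3 L] row_entry[of 2 R] L_less_R by (auto simp: cell_iff)
  qed
  then show "row n = 2 \<longleftrightarrow> T (2, R) = n" "row n \<noteq> 2 \<longleftrightarrow> row n = 3"
    by auto
qed

lemma row_1: "row 1 = 1 \<or> row 1 = 3"
proof -
  obtain y where "(row 1, y) \<in> D" "T (row 1, y) = 1"
    using obtain_column[of 1] n3 by auto
  then show ?thesis
    using row2_not_1[of y] by (auto simp: cell_iff)
qed

lemma row_pivot: "row pivot = 1"
  using crit_bounds by (intro row_entry) (auto simp: cell_iff)

lemma pivot_range: "1 \<le> pivot" "pivot < n"
  using crit_bounds entry_range[of "(1, crit)"] entry_range[of "(2, crit)"] column_less[of crit]
  by (auto simp: cell_iff)

text \<open>Links the column form of condition (2) for cyclic descents to the pivot being the first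
  letter of w.\<close>

lemma pivot_eq_1_iff: "pivot = 1 \<longleftrightarrow> row 1 = 1 \<and> crit = L + 1"
proof
  assume "pivot = 1"
  moreover from this have "crit = L + 1"
    using crit_bounds row_less[of 1 "L + 1" crit] entry_range(1)[of "(1, L + 1)"]
    by (cases "L + 1 < crit") (auto simp: cell_iff)
  ultimately show "row 1 = 1 \<and> crit = L + 1"
    using row_pivot by simp
next
  assume *: "row 1 = 1 \<and> crit = L + 1"
  then obtain y where "(1, y) \<in> D" "T (1, y) = 1"
    using obtain_column[of 1] n3 by auto
  then show "pivot = 1"
    using * crit_bounds row_le[of 1 "L + 1" y] pivot_range by (auto simp: cell_iff)
qed

text \<open>The word u before the pivot is balanced and cannot end in 1. In entries:
  \<open>m <= T (1, crit - 1) < T (2, crit - 1) < Suc m\<close> is impossible.\<close>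

lemma row_before_pivot:
  assumes "1 \<le> m" "Suc m = pivot"
  shows "row m \<noteq> 1"
proof
  assume "row m = 1"
  then obtain y where y: "(1, y) \<in> D" "T (1, y) = m"
    using assms obtain_column[of m] pivot_range by auto
  then have "y < crit"
    using assms crit_bounds row_le[of 1 crit y] by (cases "y < crit") (auto simp: cell_iff)
  then have "y \<le> crit - 1" "L < crit - 1"
    using y by (auto simp: cell_iff)
  then have "T (2, crit - 1) < Suc m" "T (1, y) \<le> T (1, crit - 1)"
    "T (1, crit - 1) < T (2, crit - 1)"
    using y \<open>y < crit\<close> assms crit_bounds crit_cases row_le[of 1 y "crit - 1"]
      column_less[of "crit - 1"]
    by (auto simp: cell_iff)
  with y show False by simp
qed

text \<open>The balanced word v between the pivot and the final 2 cannot begin with 2. The bound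
  \<open>Suc pivot < n\<close> keeps the final 2 itself out of consideration.\<close>

lemma row_after_pivot:
  assumes "Suc pivot < n" "T (2, R) = n"
  shows "row (Suc pivot) \<noteq> 2"
proof
  assume "row (Suc pivot) = 2"
  then obtain y where y: "(2, y) \<in> D" "T (2, y) = Suc pivot"
    using assms obtain_column[of "Suc pivot"] by auto
  consider "y < crit" | "y = crit" | "crit < y" by linarith
  then show False
  proof cases
    case 1
    then have "y \<le> crit - 1" "L < crit - 1" "T (2, crit - 1) < pivot"
      using y crit_cases by (auto simp: cell_iff)
    then show ?thesis
      using y crit_bounds row_le[of 2 y "crit - 1"] le_trans[OF diff_le_self crit_bounds(2)]
      by (auto simp: cell_iff)
  next
    case 2
    \<comment> \<open>The entry in \<open>(2, crit)\<close> is \<open>Suc pivot\<close>, which is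
      below \<open>n\<close>, whereas \<open>(2, R)\<close> holds \<open>n\<close>.\<close>
    then have "crit < R"
      using assms y crit_bounds by (auto simp: le_less)
    then show ?thesis
      using 2 y crit_bounds crit_less[of "Suc crit"] row_less[of 1 crit "Suc crit"]
      by (auto simp: cell_iff)
  next
    case 3
    then show ?thesis
      using y crit_bounds column_less[of crit] row_less[of 2 crit y] by (auto simp: cell_iff)
  qed
qed

text \<open>Below the entry \<open>n - 1\<close> only \<open>n\<close> fits, so both stand in the
  last column. If the slide did not turn there, \<open>T (2, R - 1)\<close> would lie strictly
  between them.\<close>

lemma row_penultimate:
  assumes "row (n - 1) = 1"
  shows "T (2, R) = n" "pivot = n - 1"
proof -
  have "1 \<le> n - 1" "n - 1 \<le> n"
    using n3 by auto
  then obtain y where y: "(1, y) \<in> D" "T (1, y) = n - 1"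
    using assms obtain_column[of "n - 1"] by metis
  then have ny: "T (2, y) = n"
    using column_less[of y] entry_range(2)[of "(2, y)"] by (auto simp: cell_iff)
  then have "y = R"
    using y L_less_R row_less[of 2 y R] entry_range(2)[of "(2, R)"]
    by (cases "y = R") (auto simp: cell_iff)
  with ny show "T (2, R) = n" by simp
  have "crit = R"
  proof (rule ccontr)
    assume "crit \<noteq> R"
    with crit_bounds have "crit < R" by simp
    then have "T (1, R) < T (2, R - 1)" "T (2, R - 1) < T (2, R)"
      using crit_bounds crit_less[of R] by (auto simp: cell_iff intro!: row_less)
    then show False
      using y ny \<open>y = R\<close> by auto
  qed
  with y \<open>y = R\<close> show "pivot = n - 1" by simp
qed

section \<open>Promotion as rotation of the word of rows\<close>

lemma row_pro_1: "row_of D (pro D T) 1 = (if T (2, R) = n then 1 else 3)"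
proof (cases rule: max_entry_cases)
  case row2
  then show ?thesis
    using row_of_entry[OF pro_SYT, of "(1, L + 1)"] pro_row2_entries(1) L_less_R
    by (auto simp: cell_iff)
next
  case row3
  moreover have "T (2, R) \<noteq> n"
    using row3 L_less_R entry_eq_iff[of "(2, R)" "(3, L)"] by (auto simp: cell_iff)
  ultimately show ?thesis
    using row_of_entry[OF pro_SYT, of "(3, 1)"] pro_row3_entries(1)
    by (auto simp: cell_iff)
qed

text \<open>\<open>pro_cell\<close> preserves rows except at \<open>(1, crit)\<close>, which it
  sends to row 2.\<close>

lemma row_pro_Suc:
  assumes "1 \<le> m" "m < n"
  shows "row_of D (pro D T) (Suc m) = (if T (2, R) = n \<and> m = pivot then 2 else row m)"
proof -
  obtain x y where xy: "(x, y) \<in> D" "T (x, y) = m"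
    using assms by (rule entry_obtain[OF _ less_imp_le])
  have "m = pivot \<longleftrightarrow> (x, y) = (1, crit)"
    using xy crit_bounds entry_eq_iff[of "(x, y)" "(1, crit)"] by (auto simp: cell_iff)
  moreover have "row_of D (pro D T) (Suc m) = fst (pro_cell (x, y))"
    using row_of_entry[OF pro_SYT, of "pro_cell (x, y)"] pro_cell[of "(x, y)"] xy assms by auto
  ultimately show ?thesis
    using xy row_entry by (auto simp: pro_cell_def)
qed

section \<open>Cyclic descents\<close>

lemma Des_iff: "m \<in> Des D T \<longleftrightarrow> 1 \<le> m \<and> m < n \<and> row m < row (Suc m)"
  using n3 by (auto simp: Des_def card_D)

text \<open>Condition (2) says that the slide cannot turn north east of the first column
  \<open>L + 1\<close>. The proof substitutes \<open>y = L + i\<close>, with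
  \<open>R = L + k\<close>.\<close>

lemma entry_condition_iff:
  "(\<forall>i. 1 < i \<and> i \<le> k \<longrightarrow> strip_entry n k T 2 (i - 1) > strip_entry n k T 1 i) \<longleftrightarrow> crit = L + 1"
proof -
  have RL: "R = L + k"
    using kn by linarith
  have "(\<forall>i. 1 < i \<and> i \<le> k \<longrightarrow> T (1, L + i) < T (2, L + (i - 1))) \<longleftrightarrow>
    (\<forall>y. L + 1 < y \<and> y \<le> R \<longrightarrow> T (1, y) < T (2, y - 1))"
  proof (intro iffI allI impI)
    fix y assume *: "\<forall>i. 1 < i \<and> i \<le> k \<longrightarrow> T (1, L + i) < T (2, L + (i - 1))"
      "L + 1 < y \<and> y \<le> R"
    from *(2) have "1 < y - L \<and> y - L \<le> k"
      using RL by linarith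
    with *(1) have "T (1, L + (y - L)) < T (2, L + (y - L - 1))"
      by blast
    moreover have "L + (y - L) = y" "L + (y - L - 1) = y - 1"
      using * by auto
    ultimately show "T (1, y) < T (2, y - 1)" by metis
  next
    fix i assume *: "\<forall>y. L + 1 < y \<and> y \<le> R \<longrightarrow> T (1, y) < T (2, y - 1)"
      "1 < i \<and> i \<le> k"
    from *(2) have "L + 1 < L + i \<and> L + i \<le> R"
      using RL by linarith
    with *(1) have "T (1, L + i) < T (2, L + i - 1)"
      by blast
    moreover have "L + i - 1 = L + (i - 1)"
      using * by auto
    ultimately show "T (1, L + i) < T (2, L + (i - 1))" by metis
  qed
  then show ?thesis
    by (simp only: crit_eq_iff strip_entry_def part_inner)
qed

text \<open>The letter in position 1 is 1 or 3, so conditions (1) and (2) merge into one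
  disjunction.\<close>

lemma cDes_eq:
  "strip_cDes n k T = Des D T \<union> (if T (2, R) = n \<and> (row 1 = 3 \<or> crit = L + 1) then {n} else {})"
  unfolding strip_cDes_def Let_def entry_condition_iff row_n using row_1 by auto

lemma cDes_iff:
  assumes "1 \<le> m" "m < n"
  shows "m \<in> strip_cDes n k T \<longleftrightarrow> row m < row (Suc m)"
  using assms by (auto simp: cDes_eq Des_iff)

lemma n_cDes_iff: "n \<in> strip_cDes n k T \<longleftrightarrow> T (2, R) = n \<and> (row 1 = 3 \<or> crit = L + 1)"
  by (auto simp: cDes_eq Des_iff)

lemma cDes_subset: "strip_cDes n k T \<subseteq> {1..n}"
  using n3 by (auto simp: cDes_eq Des_iff)

lemma cDes_restrict: "strip_cDes n k T \<inter> {1..n - 1} = Des D T"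
  using n3 by (auto simp: cDes_eq Des_iff)

text \<open>Without descents the row numbers would decrease weakly along the word, but
  \<open>T (1, R) < T (2, R)\<close> leads from row 1 to row 2.\<close>

lemma cDes_nonempty: "strip_cDes n k T \<noteq> {}"
proof
  assume empty: "strip_cDes n k T = {}"
  have le: "row (Suc m) \<le> row m" if "1 \<le> m" "m < n" for m
    using cDes_iff[OF that] empty by simp
  have "row b \<le> row a" if "a \<le> b" "1 \<le> a" "b \<le> n" for a b
    using that
  proof (induction b rule: dec_induct)
    case (step b)
    then show ?case
      using le[of b] by simp
  qed simp
  from this[of "T (1, R)" "T (2, R)"] have "(2::nat) \<le> 1"
    using L_less_R column_less[of R] entry_range[of "(1, R)"] entry_range[of "(2, R)"]
      row_entry[of 1 R] row_entry[of 2 R]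
    by (auto simp: cell_iff)
  then show False by simp
qed

text \<open>Descents everywhere put the entries 1, 2, 3 in rows 1, 2, 3. As \<open>n\<close> is in
  row 2, there is an entry 4, which would need a row below the third.\<close>

lemma cDes_proper: "strip_cDes n k T \<noteq> {1..n}"
proof
  assume full: "strip_cDes n k T = {1..n}"
  have less: "row m < row (Suc m)" if "1 \<le> m" "m < n" for m
    using cDes_iff[OF that] full that by simp
  have "row 1 < row 2" "row 2 < row 3"
    using less[of 1] less[of 2] n3 by (simp_all add: numeral_eq_Suc)
  then have "row 3 = 3"
    using row_range[of 1] row_range[of 3] n3 by auto
  moreover have "row n = 2"
    using full n3 n_cDes_iff row_n by auto
  ultimately have "3 < n"
    using n3 by (cases "n = 3") auto
  then show False
    using less[of 3] \<open>row 3 = 3\<close> row_range[of 4] by (auto simp: numeral_eq_Suc)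
qed

section \<open>Equivariance of the cyclic descent map\<close>

lemma strip_tableau_pro: "strip_tableau n k (pro D T)"
  by unfold_locales (rule pro_SYT)

text \<open>The image 1 u 2 v is balanced after 1 u 2: the closing 2, in column \<open>crit\<close>,
  comes before the next 1.\<close>

lemma pro_crit_less:
  assumes "T (2, R) = n" "crit < R"
  shows "pro D T (2, crit) < pro D T (1, Suc crit)"
  using assms crit_bounds row_less[of 1 crit "Suc crit"] pro_row2_entries(3)[of "Suc crit"]
    pro_row2_entries(5) by (auto simp: cell_iff)

text \<open>Inside 1 u 2 no shorter nonempty prefix is balanced: the next 1 always comes before the
  2 that could close it.\<close>

lemma pro_less_below_crit:
  assumes "T (2, R) = n" "L < y" "y < crit"
  shows "pro D T (1, Suc y) < pro D T (2, y)"
  using assms crit_bounds column_less[of y] pro_row2_entries(2)[of y] pro_row2_entries(4)[of y]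
  by auto

text \<open>If w ends in 2, both sides say that v is empty, that is \<open>pivot = n - 1\<close>. If
  w ends in 3, both say that the letter before it is 2.\<close>

lemma n_cDes_pro_iff:
  "n \<in> strip_cDes n k (pro D T) \<longleftrightarrow> n - 1 \<in> strip_cDes n k T"
proof -
  interpret P: strip_tableau n k "pro D T"
    by (rule strip_tableau_pro)
  have pen: "n - 1 \<in> strip_cDes n k T \<longleftrightarrow> row (n - 1) < row n"
    using n3 cDes_iff[of "n - 1"] by simp
  have row_pen: "row (n - 1) \<in> {1, 2, 3}"
    using n3 by (intro row_range) auto
  show ?thesis
  proof (cases "T (2, R) = n")
    case True
    have "n - 1 \<in> strip_cDes n k T \<longleftrightarrow> pivot = n - 1"
      using True pen row_pen row_n row_penultimate(2) row_pivot by auto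
    moreover have "n \<in> strip_cDes n k (pro D T) \<longleftrightarrow> pivot = n - 1"
    proof (cases "crit = R")
      case crit: True
      \<comment> \<open>Now v contains no 1, so the image is first balanced at its last 2 and its
        own \<open>crit\<close> is the first column. That 2 is in position
        \<open>pivot + 1\<close>.\<close>
      have "pro D T (1, y) < pro D T (2, y - 1)" if "L + 1 < y" "y \<le> R" for y
      proof -
        have "L < y - 1" "y - 1 < crit" "Suc (y - 1) = y"
          using that crit by auto
        then show ?thesis
          using pro_less_below_crit[OF True, of "y - 1"] by metis
      qed
      then have "P.crit = L + 1"
        unfolding P.crit_eq_iff by blast
      then show ?thesis
        using crit n3 pro_row2_entries(5)[OF True] by (auto simp: P.n_cDes_iff)
    next
      case False
      then have crit: "crit < R"
        using crit_bounds by simp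
      \<comment> \<open>The image is balanced before a later 1, so its own pivot is not its first
        letter.\<close>
      then have "pro D T (2, crit) < pro D T (1, Suc crit)"
        by (rule pro_crit_less[OF True])
      then have "P.crit \<noteq> L + 1"
        using crit crit_bounds P.crit_less[of "Suc crit"] by auto
      moreover have "pivot \<noteq> n - 1"
        using crit crit_bounds row_less[of 1 crit R] column_less[of R] True
        by (auto simp: cell_iff)
      ultimately show ?thesis
        by (simp add: P.n_cDes_iff row_pro_1[unfolded One_nat_def] True)
    qed
    ultimately show ?thesis by simp
  next
    case False
    \<comment> \<open>The image begins with 3 and ends with the letter \<open>row (n - 1)\<close>,
      so condition (1) decides.\<close>
    have "n \<in> strip_cDes n k (pro D T) \<longleftrightarrow> row (n - 1) = 2"
      using n3 False P.row_n(1) row_pro_1 row_pro_Suc[of "n - 1"] by (simp add: P.n_cDes_iff)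
    moreover have "row (n - 1) \<noteq> 1"
      using False row_penultimate(1) by blast
    ultimately show ?thesis
      using False pen row_pen row_n by auto
  qed
qed

text \<open>After a leading 3 there is no descent. After a leading 1 there is one exactly when the
  next letter is 3, or is a pivot turned into 2.\<close>

lemma one_cDes_pro_iff: "1 \<in> strip_cDes n k (pro D T) \<longleftrightarrow> n \<in> strip_cDes n k T"
proof -
  interpret P: strip_tableau n k "pro D T"
    by (rule strip_tableau_pro)
  have "1 \<in> strip_cDes n k (pro D T) \<longleftrightarrow>
      row_of D (pro D T) 1 < row_of D (pro D T) (Suc 1)"
    using n3 by (intro P.cDes_iff) auto
  moreover have "row_of D (pro D T) (Suc 1) = (if T (2, R) = n \<and> 1 = pivot then 2 else row 1)"
    using n3 by (intro row_pro_Suc) auto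
  ultimately show ?thesis
    using row_1 pivot_eq_1_iff row_pro_1 n_cDes_iff by auto
qed

text \<open>Rotation keeps adjacent letters adjacent, and turning the pivot from 1 into 2 affects no
  comparison: the letter before it is not 1 and the letter after it is not 2. For
  \<open>Suc m = n\<close> the pair is split by the rotation.\<close>

lemma Suc_cDes_pro_iff:
  assumes "1 \<le> m" "m < n"
  shows "Suc m \<in> strip_cDes n k (pro D T) \<longleftrightarrow> m \<in> strip_cDes n k T"
proof (cases "Suc m = n")
  case True
  then show ?thesis
    using n_cDes_pro_iff by auto
next
  case False
  interpret P: strip_tableau n k "pro D T"
    by (rule strip_tableau_pro)
  have m: "Suc m < n"
    using False assms by simp
  have "Suc m \<in> strip_cDes n k (pro D T) \<longleftrightarrow>
      row_of D (pro D T) (Suc m) < row_of D (pro D T) (Suc (Suc m))"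
    using m by (intro P.cDes_iff) auto
  moreover have "row m \<in> {1, 2, 3}" "row (Suc m) \<in> {1, 2, 3}"
    using assms row_range[of m] row_range[of "Suc m"] by auto
  ultimately show ?thesis
    using assms m cDes_iff[of m] row_pro_Suc[of m] row_pro_Suc[of "Suc m"]
      row_pivot row_before_pivot[of m] row_after_pivot
    by (cases "T (2, R) = n"; cases "m = pivot"; cases "Suc m = pivot") auto
qed

lemma cDes_pro: "strip_cDes n k (pro D T) = cyc_succ n ` strip_cDes n k T"
proof (intro set_eqI iffI)
  interpret P: strip_tableau n k "pro D T"
    by (rule strip_tableau_pro)
  fix m assume m: "m \<in> strip_cDes n k (pro D T)"
  then have "1 \<le> m" "m \<le> n"
    using P.cDes_subset by auto
  then consider "m = 1" | l where "m = Suc l" "1 \<le> l" "l < n"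
    by (cases m; cases "m = 1") auto
  then show "m \<in> cyc_succ n ` strip_cDes n k T"
  proof cases
    case 1
    then show ?thesis
      using m one_cDes_pro_iff by (intro image_eqI[of _ _ n]) (auto simp: cyc_succ_def)
  next
    case 2
    then show ?thesis
      using m Suc_cDes_pro_iff[of l] by (intro image_eqI[of _ _ l]) (auto simp: cyc_succ_def)
  qed
next
  fix m assume "m \<in> cyc_succ n ` strip_cDes n k T"
  then obtain l where l: "m = cyc_succ n l" "l \<in> strip_cDes n k T"
    by auto
  then have "1 \<le> l" "l \<le> n"
    using cDes_subset by auto
  then show "m \<in> strip_cDes n k (pro D T)"
    using l one_cDes_pro_iff Suc_cDes_pro_iff[of l]
    by (cases "l = n") (auto simp: cyc_succ_def)
qed

section \<open>Injectivity of promotion\<close>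

end

context strip
begin

text \<open>In the common image, column \<open>T.crit\<close> would be closed before the next 1
  according to \<open>T\<close>, but still open according to \<open>S\<close>.\<close>

lemma crit_not_less:
  assumes "strip_tableau n k T" "strip_tableau n k S" "pro D T = pro D S"
    and "T (2, R) = n" "S (2, R) = n"
  shows "\<not> strip_tableau.crit n k T < strip_tableau.crit n k S"
proof
  interpret T: strip_tableau n k T by fact
  interpret S: strip_tableau n k S by fact
  assume less: "T.crit < S.crit"
  then have "pro D T (2, T.crit) < pro D T (1, Suc T.crit)"
    using assms(4) S.crit_bounds by (intro T.pro_crit_less) auto
  moreover have "pro D S (1, Suc T.crit) < pro D S (2, T.crit)"
    using less assms(5) T.crit_bounds by (intro S.pro_less_below_crit) auto
  ultimately show False
    using assms(3) by simp
qed

text \<open>The row of 1 in the image tells whether w ended in 2 or 3, and in the first case the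
  image determines \<open>crit\<close>. Hence the cell of \<open>n\<close> and the map
  \<open>pro_cell\<close> are known, and \<open>pro_cell\<close> recovers the other entries.\<close>

lemma pro_inj: "inj_on (pro D) (SYT D)"
proof (rule inj_onI)
  fix T S assume TS: "T \<in> SYT D" "S \<in> SYT D" and eq: "pro D T = pro D S"
  interpret T: strip_tableau n k T by unfold_locales fact
  interpret S: strip_tableau n k S by unfold_locales fact
  have case_eq: "T (2, R) = n \<longleftrightarrow> S (2, R) = n"
  proof -
    have "(if T (2, R) = n then 1 else 3) = (if S (2, R) = n then 1 else (3::nat))"
      using T.row_pro_1 S.row_pro_1 eq by metis
    then show ?thesis
      by (simp split: if_splits)
  qed
  have "T.crit = S.crit" if "T (2, R) = n"
    using crit_not_less[of T S] crit_not_less[of S T] T.strip_tableau_axioms S.strip_tableau_axioms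
      eq that case_eq by (simp add: not_less)
  then have cell_eq: "T.pro_cell = S.pro_cell"
    by (auto simp: T.pro_cell_def S.pro_cell_def case_eq fun_eq_iff)
  have n_eq: "T c = n \<longleftrightarrow> S c = n" if "c \<in> D" for c
  proof (cases "T (2, R) = n")
    case True
    then show ?thesis
      using that L_less_R case_eq T.entry_eq_iff[of c "(2, R)"] S.entry_eq_iff[of c "(2, R)"]
      by (auto simp: cell_iff)
  next
    case False
    have "T (3, L) = n" "L \<ge> 1"
      using False by (cases rule: T.max_entry_cases; simp)+
    moreover have "S (3, L) = n"
      using False case_eq by (cases rule: S.max_entry_cases) simp_all
    ultimately have "T (3, L) = n" "S (3, L) = n" "L \<ge> 1"
      by auto
    then show ?thesis
      using that T.entry_eq_iff[of c "(3, L)"] S.entry_eq_iff[of c "(3, L)"]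
      by (auto simp: cell_iff)
  qed
  have "T c = S c" if "c \<in> D" for c
  proof (cases "T c = n")
    case True
    then show ?thesis
      using n_eq[OF that] by simp
  next
    case False
    then have "T c < n" "S c < n"
      using that n_eq[OF that] T.entry_range(2)[OF that] S.entry_range(2)[OF that]
      by (simp_all add: le_less)
    then have "Suc (T c) = Suc (S c)"
      using T.pro_cell(2)[OF that] S.pro_cell(2)[OF that] eq cell_eq by metis
    then show ?thesis by simp
  qed
  then show "T = S"
    using T.T_extensional S.T_extensional by (blast intro: extensionalityI)
qed

end

section \<open>The cyclic extension by promotion\<close>

theorem theorem4p8:
  fixes n k :: nat
  assumes "n \<ge> 3" and "0 < k" and "k \<le> n div 2"
  shows "cyclic_extension n (SYT (strip_shape n k)) (Des (strip_shape n k))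
           (strip_cDes n k) (pro (strip_shape n k))"
proof -
  interpret strip n k
    using assms by unfold_locales
  have tableau: "strip_tableau n k T" if "T \<in> SYT D" for T
    using that by unfold_locales
  note finite = finite_SYT[OF finite_D]
  have "pro D ` SYT D \<subseteq> SYT D"
    using tableau strip_tableau.pro_SYT by blast
  then have "bij_betw (pro D) (SYT D) (SYT D)"
    using pro_inj finite by (simp add: bij_betw_def endo_inj_surj)
  moreover have "Des D \<in> SYT D \<rightarrow> Pow {1..n - 1}"
    by (auto simp: Des_def card_D)
  moreover have "strip_cDes n k \<in> SYT D \<rightarrow> Pow {1..n}"
    using tableau strip_tableau.cDes_subset by blast
  moreover have "strip_cDes n k T \<inter> {1..n - 1} = Des D T \<and>
      strip_cDes n k (pro D T) = cyc_succ n ` strip_cDes n k T \<and>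
      {} \<subset> strip_cDes n k T \<and> strip_cDes n k T \<subset> {1..n}" if "T \<in> SYT D" for T
  proof -
    interpret strip_tableau n k T
      using tableau[OF that] .
    show ?thesis
      using cDes_restrict cDes_pro cDes_nonempty cDes_proper cDes_subset by blast
  qed
  ultimately show ?thesis
    using finite by (simp add: cyclic_extension_def)
qed

end
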